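(* Let $\Phi$, $\varphi$, $V$ be as in the standing assumption (see context), and suppose that $\varphi\in\mathcal Z(\mathbb R^d)$ is strictly positive, radial and decreasing. If $\varphi(0)$ is the global maximum of $\varphi$, then $V(0)\le0$.
   Context: Notation: $B_r(a)$ is the open ball in $\mathbb R^d$; $D_hf(x)=f(x+h)-2f(x)+f(x-h)$. "Radial and decreasing" means $\varphi(x)=\rho(|x|)$ with $\rho$ decreasing. $\Phi$ is a complete Bernstein function with Lévy pair $(0,\mu)$: $\Phi(u)=\int_0^\infty(1-e^{-ut})\mu(t)\,dt$ with $\mu:(0,\infty)\to[0,\infty)$ completely monotone and $\int_0^\infty\min(1,t)\mu(t)\,dt<\infty$. The jump kernel is $j(r)=(4\pi)^{-d/2}\int_0^\infty t^{-d/2}e^{-r^2/(4t)}\mu(t)\,dt$, $r>0$. $\Phi(-\Delta)$ is the operator on $L^2(\mathbb R^d)$ with Fourier multiplier $\Phi(|y|^2)$. Standing assumption: $V:\mathbb R^d\to\mathbb R$ is a potential, $H=\Phi(-\Delta)+V$, and $\varphi\in L^2(\mathbb R^d)\cap L^\infty(\mathbb R^d)$, $\varphi>0$, satisfies $H\varphi=0$. The potential is understood through the pointwise expression $V(x)=-\frac{1}{\varphi(x)}\Phi(-\Delta)\varphi(x)=\frac{1}{2\varphi(x)}\int_{\mathbb R^d}D_h\varphi(x)\,j(|h|)\,dh$. Space: $\mathcal Z(\mathbb R^d)$ is the set of $f\in L^\infty(\mathbb R^d)$ for which there exist functions $L_f,R_f:\mathbb R^d\to(0,\infty)$ such that $|D_hf(x)|\le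 L_f(x)|h|^2$ for all $x\in\mathbb R^d$ and $h\in B_{R_f(x)}(0)$. *)

theory Defs
  imports "HOL-Analysis.Analysis"
begin

text \<open>Elements are representatives (genuine functions), not classes modulo null sets, since
  pointwise values of \<open>\<phi>\<close> and \<open>V\<close> matter.\<close>

definition L2 :: "('a::euclidean_space \<Rightarrow> 'b::euclidean_space) set" where
  "L2 = {f \<in> borel_measurable lebesgue. integrable lebesgue (\<lambda>x. (norm (f x))\<^sup>2)}"

definition Linf :: "('a::euclidean_space \<Rightarrow> 'b::euclidean_space) set" where
  "Linf = {f \<in> borel_measurable lebesgue. \<exists>C. AE x in lebesgue. norm (f x) \<le> C}"

definition second_diff :: "'a::euclidean_space \<Rightarrow> ('a \<Rightarrow> real) \<Rightarrow> 'a \<Rightarrow> real" where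
  "second_diff h f x = f (x + h) - 2 * f x + f (x - h)"

definition Zspace :: "('a::euclidean_space \<Rightarrow> real) set" where
  "Zspace = {f \<in> Linf. \<exists>L R :: 'a \<Rightarrow> real.
      (\<forall>x. 0 < L x \<and> 0 < R x) \<and>
      (\<forall>x. \<forall>h \<in> ball 0 (R x). \<bar>second_diff h f x\<bar> \<le> L x * (norm h)\<^sup>2)}"

text \<open>``Decreasing'' is understood in the weak sense.\<close>

definition radial_decreasing :: "('a::euclidean_space \<Rightarrow> real) \<Rightarrow> bool" where
  "radial_decreasing f \<longleftrightarrow> (\<exists>\<rho> :: real \<Rightarrow> real. antimono_on {0..} \<rho> \<and> (\<forall>x. f x = \<rho> (norm x)))"

definition completely_monotone :: "(real \<Rightarrow> real) \<Rightarrow> bool" where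
  "completely_monotone m \<longleftrightarrow>
     (\<forall>n. \<forall>t>0. (deriv ^^ n) m field_differentiable at t \<and> 0 \<le> (- 1) ^ n * (deriv ^^ n) m t)"

text \<open>\<open>\<Phi>\<close> is a complete Bernstein function with Levy pair \<open>(0, \<mu>)\<close>. Only the values of \<open>\<mu>\<close> on
  \<open>(0, \<infinity>)\<close> and of \<open>\<Phi>\<close> on \<open>[0, \<infinity>)\<close> are relevant.\<close>

definition complete_bernstein_levy :: "(real \<Rightarrow> real) \<Rightarrow> (real \<Rightarrow> real) \<Rightarrow> bool" where
  "complete_bernstein_levy \<Phi> \<mu> \<longleftrightarrow>
     completely_monotone \<mu> \<and>
     set_integrable lborel {0<..} (\<lambda>t. min 1 t * \<mu> t) \<and>
     (\<forall>u\<ge>0. \<Phi> u = (LINT t:{0<..}|lborel. (1 - exp (- (u * t))) * \<mu> t))"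

text \<open>The argument \<open>d\<close> is the space dimension; the kernel is meaningful for \<open>r > 0\<close> only.\<close>

definition jump_kernel :: "nat \<Rightarrow> (real \<Rightarrow> real) \<Rightarrow> real \<Rightarrow> real" where
  "jump_kernel d \<mu> r = (4 * pi) powr (- real d / 2) *
     (LINT t:{0<..}|lborel. t powr (- real d / 2) * exp (- (r\<^sup>2 / (4 * t))) * \<mu> t)"

text \<open>The Fourier--Plancherel transform on \<open>L\<^sup>2\<close>, as a relation: \<open>F\<close> is the \<open>L\<^sup>2\<close> limit of
  the (unitary) Fourier integrals of \<open>f\<close> truncated to balls. It determines \<open>F\<close> up to null sets.
  The normalisation is the one for which \<open>- \<Delta>\<close> has the multiplier \<open>\<bar>y\<bar>\<^sup>2\<close>.\<close>

definition truncated_fourier ::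
    "('a::euclidean_space \<Rightarrow> complex) \<Rightarrow> real \<Rightarrow> 'a \<Rightarrow> complex" where
  "truncated_fourier f r y = complex_of_real ((2 * pi) powr (- real DIM('a) / 2)) *
     (LINT x:ball 0 r|lebesgue. cis (- (x \<bullet> y)) * f x)"

definition has_L2_fourier ::
    "('a::euclidean_space \<Rightarrow> complex) \<Rightarrow> ('a \<Rightarrow> complex) \<Rightarrow> bool" where
  "has_L2_fourier f F \<longleftrightarrow> f \<in> L2 \<and> F \<in> L2 \<and>
     ((\<lambda>r. \<integral>\<^sup>+ y. ennreal ((norm (F y - truncated_fourier f r y))\<^sup>2) \<partial>lebesgue) \<longlongrightarrow> 0) at_top"

text \<open>\<open>Phi_laplacian \<Phi> f g\<close>: \<open>f\<close> is in the (maximal) domain of \<open>\<Phi>(- \<Delta>)\<close> on \<open>L\<^sup>2\<close> and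
  \<open>\<Phi>(- \<Delta>) f = g\<close> almost everywhere. That \<open>\<Phi>(\<bar>y\<bar>\<^sup>2) F(y)\<close> is square integrable is part of
  \<open>has_L2_fourier\<close>.\<close>

definition Phi_laplacian ::
    "(real \<Rightarrow> real) \<Rightarrow> ('a::euclidean_space \<Rightarrow> complex) \<Rightarrow> ('a \<Rightarrow> complex) \<Rightarrow> bool" where
  "Phi_laplacian \<Phi> f g \<longleftrightarrow> (\<exists>F. has_L2_fourier f F \<and>
     has_L2_fourier g (\<lambda>y. complex_of_real (\<Phi> ((norm y)\<^sup>2)) * F y))"

definition zero_energy_solution ::
    "(real \<Rightarrow> real) \<Rightarrow> ('a::euclidean_space \<Rightarrow> real) \<Rightarrow> ('a \<Rightarrow> real) \<Rightarrow> bool" where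
  "zero_energy_solution \<Phi> V \<phi> \<longleftrightarrow>
     (\<exists>g. Phi_laplacian \<Phi> (\<lambda>x. complex_of_real (\<phi> x)) g \<and>
          (AE x in lebesgue. g x + complex_of_real (V x * \<phi> x) = 0))"

text \<open>\<open>zero_energy_solution\<close> fixes \<open>V\<close> only up to null sets; this is the pointwise version, with
  \<open>\<Phi>(- \<Delta>) \<phi> (x) = - 1/2 \<integral> D\<^sub>h \<phi>(x) j(\<bar>h\<bar>) dh\<close>.\<close>

definition pointwise_potential ::
    "(real \<Rightarrow> real) \<Rightarrow> ('a::euclidean_space \<Rightarrow> real) \<Rightarrow> 'a \<Rightarrow> real" where
  "pointwise_potential \<mu> \<phi> x = 1 / (2 * \<phi> x) *
     (LINT h|lebesgue. second_diff h \<phi> x * jump_kernel DIM('a) \<mu> (norm h))"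

end

theory Submission
  imports Defs
begin

text \<open>The integrand in \<open>V(0)\<close> has a sign. At a global maximum the second difference
  \<open>\<phi>(h) - 2 \<phi>(0) + \<phi>(-h)\<close> is nonpositive for every \<open>h\<close>, while the jump kernel is a mixture of
  heat kernels weighted by \<open>\<mu> \<ge> 0\<close> and is thus nonnegative (\<open>jump_kernel_nonneg\<close>).
  Their product integrates to a nonpositive number, and the factor \<open>1 / (2 \<phi>(0))\<close> is positive.
  The Bochner integral is \<open>0\<close> by convention when the integrand is not integrable, so monotonicity
  in the form used here covers that case as well.\<close>

lemma completely_monotone_nonneg:
  assumes "completely_monotone m" and "0 < t"
  shows "0 \<le> m t"
proof -
  have "0 \<le> (- 1) ^ 0 * (deriv ^^ 0) m t"
    using assms unfolding completely_monotone_def by blast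
  then show ?thesis by simp
qed

lemma jump_kernel_nonneg:
  assumes "\<And>t. 0 < t \<Longrightarrow> 0 \<le> \<mu> t"
  shows "0 \<le> jump_kernel d \<mu> r"
  unfolding jump_kernel_def set_lebesgue_integral_def
  by (intro mult_nonneg_nonneg integral_nonneg_AE) (auto simp: indicator_def assms)

lemma second_diff_nonpos_at_max:
  assumes "\<forall>y. f y \<le> f x"
  shows "second_diff h f x \<le> 0"
  using assms[rule_format, of "x + h"] assms[rule_format, of "x - h"]
  by (simp add: second_diff_def)

lemma pointwise_potential_nonpos_at_max:
  fixes \<phi> :: "'a::euclidean_space \<Rightarrow> real"
  assumes "\<And>t. 0 < t \<Longrightarrow> 0 \<le> \<mu> t" and "0 < \<phi> x" and "\<forall>y. \<phi> y \<le> \<phi> x"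
  shows "pointwise_potential \<mu> \<phi> x \<le> 0"
proof -
  let ?I = "\<lambda>h. second_diff h \<phi> x * jump_kernel DIM('a) \<mu> (norm h)"
  have "?I h \<le> 0" for h
    using second_diff_nonpos_at_max[OF assms(3)] jump_kernel_nonneg[OF assms(1)]
    by (rule mult_nonpos_nonneg)
  then have "0 \<le> (LINT h|lebesgue. - ?I h)"
    by (intro integral_nonneg_AE) simp
  then have "(LINT h|lebesgue. ?I h) \<le> 0"
    by simp
  then show ?thesis
    unfolding pointwise_potential_def using assms(2)
    by (intro mult_nonneg_nonpos) auto
qed

theorem theorem7p5:
  fixes \<Phi> \<mu> :: "real \<Rightarrow> real"
    and \<phi> V :: "'a::euclidean_space \<Rightarrow> real"
  assumes "complete_bernstein_levy \<Phi> \<mu>"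
    and "\<phi> \<in> L2" and "\<phi> \<in> Linf" and "\<forall>x. 0 < \<phi> x"
    and "zero_energy_solution \<Phi> V \<phi>"
    and "\<forall>x. V x = pointwise_potential \<mu> \<phi> x"
    and "\<phi> \<in> Zspace"
    and "radial_decreasing \<phi>"
    and "\<forall>x. \<phi> x \<le> \<phi> 0"
  shows "V 0 \<le> 0"
proof -
  have "0 \<le> \<mu> t" if "0 < t" for t
    using assms(1) that completely_monotone_nonneg
    unfolding complete_bernstein_levy_def by blast
  then have "pointwise_potential \<mu> \<phi> 0 \<le> 0"
    using assms(4,9) by (intro pointwise_potential_nonpos_at_max) auto
  then show ?thesis
    using assms(6) by simp
qed

end
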